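(* Let $d\ge 2$ be an integer, let $0\le q<1$ and let $p\in[0,1]$. Then the frog model with death $1-q$ and drift $p$ on the $d$-ary tree, $\mathrm{FM}(d,q,p)$, is transient almost surely if at least one of the following holds: (a) $q\le 1/2$ or $p\ge 2-q^{-1}$ (the second inequality being considered only when $q>0$); (b) $p<\dfrac{1}{1+qd}$.
   Context: Let $\mathbb T_d$ be the infinite rooted $d$-ary tree (every vertex, including the root, has exactly $d$ children). The frog model with death $1-q$ and drift $p$, denoted $\mathrm{FM}(d,q,p)$, is the following discrete-time process. Initially there is one active frog at the root and one sleeping frog at each non-root vertex. Before taking each step, each active frog independently dies (and is removed) with probability $1-q$; with probability $q$ it survives and jumps. A surviving active frog at a non-root vertex moves to the parent of its current vertex with probability $p$ and with probability $1-p$ moves to a uniformly chosen child of its current vertex. A surviving active frog at the root stays in place with probability $p$ and with probability $1-p$ moves to a uniformly chosen child of the root. All choices are independent across frogs and steps. Whenever an active frog visits a vertex containing a sleeping frog, that sleeping frog becomes active and from then on follows the same rules independently. A realization of the process is called recurrent if the root is visited by infinitely many active frogs, and transient otherwise. *)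

theory Defs
  imports "HOL-Probability.Probability"
begin

text \<open>
  A vertex of the rooted \<open>d\<close>-ary tree is the list of child indices leading to it from the root,
  most recent choice first: the root is \<open>[]\<close>, the children of \<open>x\<close> are \<open>i # x\<close> for \<open>i < d\<close>, and the
  parent of a non-root vertex \<open>x\<close> is \<open>tl x\<close>.
\<close>

definition tree_vertices :: "nat \<Rightarrow> nat list set" where
  "tree_vertices d = lists {..<d}"

datatype move = Die | Up | Down nat

definition move_pmf :: "nat \<Rightarrow> real \<Rightarrow> real \<Rightarrow> move pmf" where
  "move_pmf d q p =
     bind_pmf (bernoulli_pmf q) (\<lambda>survives.
       if survives then
         bind_pmf (bernoulli_pmf p) (\<lambda>up.
           if up then return_pmf Up else map_pmf Down (pmf_of_set {..<d}))
       else return_pmf Die)"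

text \<open>There is one frog per vertex, so frogs are named by their starting vertices.\<close>

datatype frog_state = Sleeping | Active "nat list" | Dead

text \<open>Since \<open>tl [] = []\<close>, a frog at the root that draws \<open>Up\<close> stays in place.\<close>

fun jump :: "move \<Rightarrow> nat list \<Rightarrow> frog_state" where
  "jump Die x = Dead"
| "jump Up x = Active (tl x)"
| "jump (Down i) x = Active (i # x)"

text \<open>
  One time step, in which the frog \<open>v\<close> uses the draw \<open>m v\<close> if it is active. A frog woken by an
  arrival in this step makes its own first move in the next one.
\<close>

definition frog_step ::
    "nat \<Rightarrow> (nat list \<Rightarrow> move) \<Rightarrow> (nat list \<Rightarrow> frog_state) \<Rightarrow> nat list \<Rightarrow> frog_state" where
  "frog_step d m c v =
     (case c v of
        Sleeping \<Rightarrow>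
          if \<exists>u\<in>tree_vertices d. \<exists>x. c u = Active x \<and> jump (m u) x = Active v
          then Active v else Sleeping
      | Active x \<Rightarrow> jump (m v) x
      | Dead \<Rightarrow> Dead)"

text \<open>\<open>\<omega> (v, n)\<close> is the draw of frog \<open>v\<close> for the step from time \<open>n\<close> to time \<open>n + 1\<close>.\<close>

primrec frog_config :: "nat \<Rightarrow> (nat list \<times> nat \<Rightarrow> move) \<Rightarrow> nat \<Rightarrow> nat list \<Rightarrow> frog_state" where
  "frog_config d \<omega> 0 = (\<lambda>v. if v = [] then Active [] else Sleeping)"
| "frog_config d \<omega> (Suc n) = frog_step d (\<lambda>v. \<omega> (v, n)) (frog_config d \<omega> n)"

definition frog_space :: "nat \<Rightarrow> real \<Rightarrow> real \<Rightarrow> (nat list \<times> nat \<Rightarrow> move) measure" where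
  "frog_space d q p =
     (\<Pi>\<^sub>M vn \<in> tree_vertices d \<times> UNIV. measure_pmf (move_pmf d q p))"

definition recurrent :: "nat \<Rightarrow> (nat list \<times> nat \<Rightarrow> move) \<Rightarrow> bool" where
  "recurrent d \<omega> \<longleftrightarrow>
     infinite {v \<in> tree_vertices d. \<exists>n. frog_config d \<omega> n v = Active []}"

definition transient :: "nat \<Rightarrow> (nat list \<times> nat \<Rightarrow> move) \<Rightarrow> bool" where
  "transient d \<omega> \<longleftrightarrow> \<not> recurrent d \<omega>"

end

theory Submission
  imports Defs
begin

text \<open>
  Condition (a) says \<open>q * (2 - p) \<le> 1\<close>. An active frog leaves no active frog behind when it dies, one
  when it moves up, and at most two when it moves down, so the expected number of active frogs never
  increases. While at most \<open>K\<close> frogs are active, they all die in the next step with probability at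
  least \<open>(1 - q) ^ K\<close>; with Markov's inequality this forces the survival probability to tend to \<open>0\<close>,
  also in the critical case.

  Under condition (b), put \<open>a = q * (p + (1 - p) / d\<^sup>2)\<close>. Then \<open>a < 1 / d\<close> and
  \<open>q * (p + (1 - p) * a\<^sup>2) \<le> a\<close>, so \<open>a\<close> to the power of the current distance from the root is a
  supermartingale for each single frog, however late it is woken. It drops by at least \<open>1 - q\<close> on
  average at each visit of the root, hence a frog from level \<open>k\<close> ever visits the root with
  probability at most \<open>a ^ k / (1 - q)\<close>. As level \<open>k\<close> has \<open>d ^ k\<close> vertices and \<open>a * d < 1\<close>,
  Borel--Cantelli applies.
\<close>

section \<open>Deterministic dynamics: visited vertices and awake frogs\<close>

instance move :: countable by countable_datatype
instance frog_state :: countable by countable_datatype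

definition active_frogs :: "nat \<Rightarrow> (nat list \<times> nat \<Rightarrow> move) \<Rightarrow> nat \<Rightarrow> nat list set" where
  "active_frogs d \<omega> n = {v \<in> tree_vertices d. \<exists>x. frog_config d \<omega> n v = Active x}"

text \<open>Adaptedness: the first \<open>n\<close> steps consume only draws with time index below
  \<open>n\<close>. This is what later makes the draws at time \<open>n\<close> independent of the
  configuration at time \<open>n\<close>.\<close>

lemma frog_config_cong:
  assumes "\<And>v m. v \<in> tree_vertices d \<Longrightarrow> m < n \<Longrightarrow> \<omega> (v, m) = \<omega>' (v, m)"
    and "v \<in> tree_vertices d"
  shows "frog_config d \<omega> n v = frog_config d \<omega>' n v"
  using assms
proof (induction n arbitrary: v)
  case (Suc n)
  have IH: "frog_config d \<omega> n u = frog_config d \<omega>' n u" if "u \<in> tree_vertices d" for u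
    using Suc that by auto
  have "\<omega> (u, n) = \<omega>' (u, n)" if "u \<in> tree_vertices d" for u
    using Suc that by auto
  then show ?case
    using IH Suc.prems(2) by (auto simp: frog_step_def split: frog_state.split)
qed simp

lemma frog_config_not_sleeping_mono:
  assumes "frog_config d \<omega> m v \<noteq> Sleeping" "m \<le> n"
  shows "frog_config d \<omega> n v \<noteq> Sleeping"
proof -
  have [simp]: "jump a x \<noteq> Sleeping" for a x
    by (cases a) auto
  show ?thesis
    using assms(2,1)
    by (induction rule: dec_induct) (auto simp: frog_step_def split: frog_state.splits)
qed

lemma frog_config_SucE:
  assumes "frog_config d \<omega> (Suc n) v = Active y" "v \<in> tree_vertices d"
  obtains x where "frog_config d \<omega> n v = Active x" "jump (\<omega> (v, n)) x = Active y"
  | u x where "frog_config d \<omega> n v = Sleeping" "y = v" "u \<in> tree_vertices d"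
      "frog_config d \<omega> n u = Active x" "jump (\<omega> (u, n)) x = Active v"
proof (cases "frog_config d \<omega> n v")
  case Sleeping
  with assms have "y = v"
    "\<exists>u\<in>tree_vertices d. \<exists>x. frog_config d \<omega> n u = Active x \<and> jump (\<omega> (u, n)) x = Active v"
    by (simp_all add: frog_step_def split: if_splits)
  then show ?thesis using that(2)[OF Sleeping] by blast
qed (use assms that(1) in \<open>simp_all add: frog_step_def\<close>)

lemma frog_config_visited:
  assumes "u \<in> tree_vertices d" "frog_config d \<omega> n u = Active x"
    "jump (\<omega> (u, n)) x = Active y"
  shows "frog_config d \<omega> (Suc n) y \<noteq> Sleeping"
proof (cases "frog_config d \<omega> n y")
  case Sleeping
  then show ?thesis using assms by (auto simp: frog_step_def)
qed (use frog_config_not_sleeping_mono[of d \<omega> n y "Suc n"] in auto)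

text \<open>The visited vertices are closed under taking parents, because frogs move along edges: an
  upward move stays among visited ancestors, a downward move adds a child below them.
  \<open>drop k x\<close> runs through \<open>x\<close> and all its ancestors, and a vertex counts
  as visited when its frog is not \<open>Sleeping\<close>. Hence upward moves wake nobody.\<close>

lemma frog_config_active_position:
  assumes "v \<in> tree_vertices d" "frog_config d \<omega> n v = Active x"
  shows "length x \<le> n \<and> (\<forall>k. frog_config d \<omega> n (drop k x) \<noteq> Sleeping)"
  using assms
proof (induction n arbitrary: v x)
  case (Suc n)
  \<comment> \<open>Used with the frog itself if it was already active, and with the waking frog if
    \<open>v\<close> has just been woken, since \<open>v\<close> then stands where its waker
    landed.\<close>
  have target: "length y \<le> Suc n \<and> (\<forall>k. frog_config d \<omega> (Suc n) (drop k y) \<noteq> Sleeping)"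
    if u: "u \<in> tree_vertices d" "frog_config d \<omega> n u = Active z" "jump (\<omega> (u, n)) z = Active y"
    for u z y
  proof -
    have z: "length z \<le> n" "\<And>k. frog_config d \<omega> (Suc n) (drop k z) \<noteq> Sleeping"
      using Suc.IH[OF u(1,2)] frog_config_not_sleeping_mono[of d \<omega> n _ "Suc n"] by auto
    show ?thesis
    proof (cases "\<omega> (u, n)")
      case Up
      then have "y = tl z" using u by auto
      then show ?thesis using z by (auto simp: drop_Suc[symmetric] simp del: frog_config.simps)
    next
      case (Down i)
      then have y: "y = i # z" using u by auto
      have "frog_config d \<omega> (Suc n) (drop k y) \<noteq> Sleeping" for k
        using z(2) frog_config_visited[OF u] unfolding y by (cases k) (auto simp del: frog_config.simps)
      then show ?thesis using z(1) y by auto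
    qed (use u in auto)
  qed
  show ?case
    using Suc.prems(2,1)
  proof (cases rule: frog_config_SucE)
    case 1
    with target[OF Suc.prems(1)] show ?thesis by blast
  next
    case (2 u z)
    with target[of u z v] show ?thesis by blast
  qed
qed (simp split: if_splits)

text \<open>A frog is woken by an arrival at its starting vertex, and arrivals advance at most one
  level per step. Later sums over frogs are finite for this reason.\<close>

lemma frog_config_length_le:
  assumes "v \<in> tree_vertices d" "frog_config d \<omega> n v \<noteq> Sleeping"
  shows "length v \<le> n"
  using assms
proof (induction n)
  case (Suc n)
  show ?case
  proof (cases "frog_config d \<omega> n v = Sleeping")
    case True
    then have "frog_config d \<omega> (Suc n) v = Active v"
      using Suc.prems(2) by (simp add: frog_step_def split: if_splits)
    then show ?thesis
      using frog_config_active_position[OF Suc.prems(1)] by blast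
  next
    case False
    then show ?thesis using Suc.IH[OF Suc.prems(1)] by simp
  qed
qed (simp split: if_splits)

lemma finite_tree_vertices_length_le: "finite {v \<in> tree_vertices d. length v \<le> n}"
  using finite_lists_length_le[of "{..<d}" n] by (simp add: tree_vertices_def lists_eq_set)

lemma active_frogs_subset: "active_frogs d \<omega> n \<subseteq> {v \<in> tree_vertices d. length v \<le> n}"
  using frog_config_length_le[of _ d \<omega> n] by (force simp: active_frogs_def)

lemma finite_active_frogs: "finite (active_frogs d \<omega> n)"
  using active_frogs_subset finite_tree_vertices_length_le by (rule finite_subset)

section \<open>Offspring counts and extinction\<close>

primrec offspring :: "move \<Rightarrow> real" where
  "offspring Die = 0"
| "offspring Up = 1"
| "offspring (Down i) = 2"

text \<open>
  A step towards the root wakes nobody, because all ancestors of an active frog's position have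
  already been visited. Hence each newly woken frog can be charged to a different downward move.
\<close>

lemma card_active_frogs_Suc_le:
  "real (card (active_frogs d \<omega> (Suc n))) \<le> (\<Sum>u\<in>active_frogs d \<omega> n. offspring (\<omega> (u, n)))"
proof -
  define A where "A = active_frogs d \<omega> n"
  define B where "B = {u \<in> A. \<omega> (u, n) \<noteq> Die}"
  define C where "C = {u \<in> A. \<exists>i. \<omega> (u, n) = Down i}"
  \<comment> \<open>Frogs are named by starting vertices, so the position of \<open>u\<close> after
    the step is also the name of the frog that \<open>u\<close> may wake. Hence the image of
    \<open>C\<close> under \<open>pos\<close> contains every newly woken frog.\<close>
  define pos where "pos u = (THE y. frog_config d \<omega> (Suc n) u = Active y)" for u
  have fin: "finite A" "finite B" "finite C"
    by (auto simp: A_def B_def C_def finite_active_frogs)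
  have "active_frogs d \<omega> (Suc n) \<subseteq> B \<union> pos ` C"
  proof
    fix v assume "v \<in> active_frogs d \<omega> (Suc n)"
    then obtain y where v: "v \<in> tree_vertices d" and y: "frog_config d \<omega> (Suc n) v = Active y"
      by (auto simp: active_frogs_def)
    from y v show "v \<in> B \<union> pos ` C"
    proof (cases rule: frog_config_SucE)
      case (1 x)
      then show ?thesis using v by (auto simp: A_def B_def active_frogs_def)
    next
      case (2 u x)
      have "\<omega> (u, n) \<noteq> Up"
      proof
        assume "\<omega> (u, n) = Up"
        then have "v = drop 1 x" using 2 by (auto simp: drop_Suc)
        then show False using frog_config_active_position 2 by blast
      qed
      then have "u \<in> C" using 2 by (cases "\<omega> (u, n)") (auto simp: A_def C_def active_frogs_def)
      moreover have "pos u = v" using 2 by (simp add: pos_def frog_step_def)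
      ultimately show ?thesis by auto
    qed
  qed
  then have "card (active_frogs d \<omega> (Suc n)) \<le> card (B \<union> pos ` C)"
    using fin by (intro card_mono) auto
  also have "\<dots> \<le> card B + card C"
    using card_Un_le[of B "pos ` C"] card_image_le[OF fin(3), of pos] by linarith
  finally have "real (card (active_frogs d \<omega> (Suc n))) \<le> real (card B) + real (card C)"
    by linarith
  also have "\<dots> = (\<Sum>u\<in>A. of_bool (\<omega> (u, n) \<noteq> Die)) + (\<Sum>u\<in>A. of_bool (\<exists>i. \<omega> (u, n) = Down i))"
    using fin by (simp add: B_def C_def sum.If_cases of_bool_def Int_def conj_commute)
  also have "\<dots> = (\<Sum>u\<in>A. offspring (\<omega> (u, n)))"
    unfolding sum.distrib[symmetric]
  proof (rule sum.cong)
    show "of_bool (\<omega> (u, n) \<noteq> Die) + of_bool (\<exists>i. \<omega> (u, n) = Down i) = offspring (\<omega> (u, n))" for u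
      by (cases "\<omega> (u, n)") auto
  qed simp
  finally show ?thesis by (simp add: A_def)
qed

text \<open>All offspring numbers vanish. With no active frog at time \<open>n\<close> the
  hypothesis holds vacuously, so this also shows that extinction is permanent.\<close>

lemma active_frogs_Suc_empty:
  assumes "\<And>v. v \<in> active_frogs d \<omega> n \<Longrightarrow> \<omega> (v, n) = Die"
  shows "active_frogs d \<omega> (Suc n) = {}"
proof -
  have "(\<Sum>u\<in>active_frogs d \<omega> n. offspring (\<omega> (u, n))) = 0"
    using assms by (intro sum.neutral) auto
  then have "card (active_frogs d \<omega> (Suc n)) = 0"
    using card_active_frogs_Suc_le[of d \<omega> n] by simp
  then show ?thesis using finite_active_frogs[of d \<omega> "Suc n"] by simp
qed

lemma frog_config_stationary:
  assumes "active_frogs d \<omega> n = {}" "n \<le> m" "v \<in> tree_vertices d"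
  shows "frog_config d \<omega> m v = frog_config d \<omega> n v"
  using assms(2,3)
proof (induction arbitrary: v rule: dec_induct)
  case (step m)
  have "frog_config d \<omega> m u \<noteq> Active x" if "u \<in> tree_vertices d" for u x
    using step.IH[OF that] assms(1) that by (auto simp: active_frogs_def)
  then have "frog_config d \<omega> (Suc m) v = frog_config d \<omega> m v"
    using step.prems by (auto simp: frog_step_def split: frog_state.split)
  then show ?case using step by simp
qed simp

text \<open>From time \<open>n\<close> on the configuration on the tree is frozen without active
  frogs, so every visit to the root happened before. Its frog was awake by time \<open>n\<close> and
  thus started within distance \<open>n\<close>, which leaves finitely many candidates.\<close>

lemma transient_if_extinct:
  assumes "active_frogs d \<omega> n = {}"
  shows "transient d \<omega>"
proof -
  have "{v \<in> tree_vertices d. \<exists>m. frog_config d \<omega> m v = Active []}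
    \<subseteq> {v \<in> tree_vertices d. length v \<le> n}"
  proof safe
    fix v m assume v: "v \<in> tree_vertices d" "frog_config d \<omega> m v = Active []"
    have "frog_config d \<omega> n v \<noteq> Active []"
      using assms v(1) by (auto simp: active_frogs_def)
    then have "m \<le> n"
      using frog_config_stationary[OF assms _ v(1), of m] v(2) by (metis nat_le_linear)
    then have "frog_config d \<omega> n v \<noteq> Sleeping"
      using frog_config_not_sleeping_mono[of d \<omega> m v n] v(2) by simp
    then show "length v \<le> n"
      by (rule frog_config_length_le[OF v(1)])
  qed
  then show ?thesis
    unfolding transient_def recurrent_def
    using finite_tree_vertices_length_le finite_subset by blast
qed

section \<open>Measurability and the mean of one draw\<close>

lemma measurable_frog_config:
  assumes "tree_vertices d \<times> {..<n} \<subseteq> I" "v \<in> tree_vertices d"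
  shows "(\<lambda>\<omega>. frog_config d \<omega> n v) \<in> PiM I (\<lambda>_. measure_pmf P) \<rightarrow>\<^sub>M count_space UNIV"
  using assms
proof (induction n arbitrary: v)
  case (Suc n)
  let ?M = "PiM I (\<lambda>_. measure_pmf P)"
  have IH [measurable]: "(\<lambda>\<omega>. frog_config d \<omega> n u) \<in> ?M \<rightarrow>\<^sub>M count_space UNIV"
    if "u \<in> tree_vertices d" for u
    using Suc.IH[OF _ that] Suc.prems(1) by (auto simp: subset_iff)
  have draw: "(\<lambda>\<omega>. \<omega> (u, n)) \<in> ?M \<rightarrow>\<^sub>M count_space UNIV" if "u \<in> tree_vertices d" for u
    using measurable_component_singleton[of "(u, n)" I "\<lambda>_. measure_pmf P"] Suc.prems(1) that
    by (auto simp: measurable_pmf_measure2)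
  \<comment> \<open>States form a countable type, so it suffices to check measurability with the
    random state replaced by each fixed one.\<close>
  have joint: "(\<lambda>\<omega>. F (frog_config d \<omega> n u) (\<omega> (u, n))) \<in> ?M \<rightarrow>\<^sub>M count_space UNIV"
    if "u \<in> tree_vertices d" for u and F :: "frog_state \<Rightarrow> move \<Rightarrow> 'b"
    by (rule measurable_compose_countable[OF _ IH[OF that]])
       (rule measurable_compose[OF draw[OF that]], simp)
  have ex: "Measurable.pred ?M (\<lambda>\<omega>. \<exists>u\<in>tree_vertices d. \<exists>x.
      frog_config d \<omega> n u = Active x \<and> jump (\<omega> (u, n)) x = Active v)"
    by (intro pred_intros_countable_bounded pred_intros_countable joint) auto
  show ?case
    unfolding frog_config.simps frog_step_def
  proof (rule measurable_compose_countable[OF _ IH[OF Suc.prems(2)]])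
    fix s
    show "(\<lambda>\<omega>. case s of
           Sleeping \<Rightarrow> if \<exists>u\<in>tree_vertices d. \<exists>x. frog_config d \<omega> n u = Active x \<and> jump (\<omega> (u, n)) x = Active v
              then Active v else Sleeping
         | Active x \<Rightarrow> jump (\<omega> (v, n)) x | Dead \<Rightarrow> Dead) \<in> ?M \<rightarrow>\<^sub>M count_space UNIV"
      using ex by (cases s) (auto simp: pred_def intro!: measurable_If joint[OF Suc.prems(2), of "\<lambda>_ m. jump m _"])
  qed
qed simp

text \<open>The functionals of a draw needed below see the type of the move but not the child
  chosen, so one value \<open>b\<close> stands for all downward moves.\<close>

lemma expectation_move_pmf:
  assumes "d > 0" "0 \<le> q" "q \<le> 1" "0 \<le> p" "p \<le> 1" and "\<And>i. g (Down i) = b"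
  shows "measure_pmf.expectation (move_pmf d q p) g = (1 - q) * g Die + q * (p * g Up + (1 - p) * b)"
proof -
  have down: "measure_pmf.expectation (map_pmf Down (pmf_of_set {..<d})) g = b"
    using assms(6) by simp
  have fin: "finite (set_pmf (map_pmf Down (pmf_of_set {..<d})))"
    using \<open>d > 0\<close> by (simp add: set_pmf_of_set lessThan_empty_iff)
  define r where "r = bind_pmf (bernoulli_pmf p)
    (\<lambda>up. if up then return_pmf Up else map_pmf Down (pmf_of_set {..<d}))"
  have "measure_pmf.expectation r g = p * g Up + (1 - p) * b"
    unfolding r_def using assms(4,5) down fin
    by (subst pmf_expectation_bind[of UNIV]) (auto simp: UNIV_bool)
  moreover have "finite (set_pmf r)"
    using fin by (auto simp: r_def)
  ultimately show ?thesis
    unfolding move_pmf_def r_def[symmetric] using assms(2,3)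
    by (subst pmf_expectation_bind[of UNIV]) (auto simp: UNIV_bool)
qed

lemma frog_config_restrict:
  assumes "v \<in> tree_vertices d"
  shows "frog_config d (restrict \<omega> (tree_vertices d \<times> {..<n})) n v = frog_config d \<omega> n v"
  using assms by (intro frog_config_cong) auto

text \<open>Replaces the random index set by a fixed finite ball, so that expectations can be taken
  term by term.\<close>

lemma sum_active_frogs:
  fixes f :: "nat list \<Rightarrow> real"
  shows "(\<Sum>v\<in>active_frogs d \<omega> n. f v) =
    (\<Sum>v | v \<in> tree_vertices d \<and> length v \<le> n. of_bool (\<exists>x. frog_config d \<omega> n v = Active x) * f v)"
  by (rule sum.mono_neutral_cong_left)
     (use finite_tree_vertices_length_le active_frogs_subset in \<open>auto simp: active_frogs_def\<close>)

text \<open>Only a finite ball has to be inspected. The index set \<open>I\<close> is general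
  because the event is needed both on the full space and on the draws before time \<open>n\<close>
  alone.\<close>

lemma measurable_active_frogs_eq:
  assumes "tree_vertices d \<times> {..<n} \<subseteq> I"
  shows "Measurable.pred (PiM I (\<lambda>_. measure_pmf P)) (\<lambda>\<omega>. active_frogs d \<omega> n = S)"
proof (cases "S \<subseteq> {v \<in> tree_vertices d. length v \<le> n}")
  case True
  have "active_frogs d \<omega> n = S \<longleftrightarrow>
      (\<forall>v\<in>{v \<in> tree_vertices d. length v \<le> n}. (\<exists>x. frog_config d \<omega> n v = Active x) = (v \<in> S))" for \<omega>
    using True active_frogs_subset[of d \<omega> n] by (auto simp: active_frogs_def)
  then show ?thesis
    by (simp only:) (intro pred_intros_finite finite_tree_vertices_length_le
      measurable_compose[OF measurable_frog_config[OF assms]], auto)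
next
  case False
  then have "active_frogs d \<omega> n \<noteq> S" for \<omega>
    using active_frogs_subset by blast
  then show ?thesis by simp
qed

section \<open>The probability space and independence of the next draws from the past\<close>

locale frog_model =
  fixes d :: nat and q p :: real
  assumes d_pos: "d > 0" and q: "0 \<le> q" "q \<le> 1" and p: "0 \<le> p" "p \<le> 1"
begin

abbreviation "draw \<equiv> measure_pmf (move_pmf d q p)"
abbreviation "M \<equiv> frog_space d q p"
abbreviation "past n \<equiv> tree_vertices d \<times> {..<n :: nat}"

sublocale prob_space M
  unfolding frog_space_def by (intro prob_space_PiM prob_space_measure_pmf)

lemma draw_measurable:
  "v \<in> tree_vertices d \<Longrightarrow> (\<lambda>\<omega>. \<omega> (v, n)) \<in> M \<rightarrow>\<^sub>M draw"
  unfolding frog_space_def by (rule measurable_component_singleton) auto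

lemma config_measurable:
  "v \<in> tree_vertices d \<Longrightarrow> (\<lambda>\<omega>. frog_config d \<omega> n v) \<in> M \<rightarrow>\<^sub>M count_space UNIV"
  unfolding frog_space_def by (rule measurable_frog_config) auto

lemma active_frogs_eq_measurable: "Measurable.pred M (\<lambda>\<omega>. active_frogs d \<omega> n = S)"
  unfolding frog_space_def by (rule measurable_active_frogs_eq) auto

lemma expectation_of_bool:
  "Measurable.pred M P \<Longrightarrow> expectation (\<lambda>\<omega>. of_bool (P \<omega>)) = prob {\<omega> \<in> space M. P \<omega>}"
  by (subst Bochner_Integration.integral_cong[where g = "indicator {\<omega> \<in> space M. P \<omega>}"])
     (auto simp: indicator_def)

lemma integrable_bounded:
  fixes f :: "_ \<Rightarrow> real"
  shows "f \<in> borel_measurable M \<Longrightarrow> (\<And>\<omega>. \<bar>f \<omega>\<bar> \<le> B) \<Longrightarrow> integrable M f"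
  by (rule integrable_const_bound[of _ B]) auto

lemma distr_draw: "v \<in> tree_vertices d \<Longrightarrow> distr M draw (\<lambda>\<omega>. \<omega> (v, n)) = draw"
  unfolding frog_space_def
  by (rule distr_PiM_component) (auto intro: prob_space_measure_pmf)

lemma indep_draws: "indep_vars (\<lambda>_. draw) (\<lambda>i \<omega>. \<omega> i) (tree_vertices d \<times> UNIV)"
proof (subst indep_vars_iff_distr_eq_PiM')
  \<comment> \<open>Points of a product space are extensional, so restricting them to the index set
    changes nothing and the joint law of the coordinates is \<open>M\<close> itself.\<close>
  have "distr M (\<Pi>\<^sub>M i\<in>tree_vertices d \<times> UNIV. draw) (\<lambda>\<omega>. \<lambda>i\<in>tree_vertices d \<times> UNIV. \<omega> i) = distr M M (\<lambda>\<omega>. \<omega>)"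
    by (rule distr_cong) (auto simp: frog_space_def space_PiM PiE_restrict)
  also have "\<dots> = (\<Pi>\<^sub>M i\<in>tree_vertices d \<times> UNIV. distr M draw (\<lambda>\<omega>. \<omega> i))"
    by (subst distr_id) (auto simp: frog_space_def distr_draw[unfolded frog_space_def] intro!: PiM_cong)
  finally show "distr M (\<Pi>\<^sub>M i\<in>tree_vertices d \<times> UNIV. draw) (\<lambda>\<omega>. \<lambda>i\<in>tree_vertices d \<times> UNIV. \<omega> i) =
    (\<Pi>\<^sub>M i\<in>tree_vertices d \<times> UNIV. distr M draw (\<lambda>\<omega>. \<omega> i))" .
  have "[] \<in> tree_vertices d" by (simp add: tree_vertices_def)
  then show "tree_vertices d \<times> UNIV \<noteq> {}" by auto
qed (use draw_measurable in auto)

lemma expectation_draw: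
  fixes g :: "move \<Rightarrow> real"
  assumes "v \<in> tree_vertices d"
  shows "expectation (\<lambda>\<omega>. g (\<omega> (v, n))) = measure_pmf.expectation (move_pmf d q p) g"
  using integral_distr[OF draw_measurable[OF assms], of g n] distr_draw[OF assms, of n] by simp

text \<open>\<open>X\<close> depends only on draws before time \<open>n\<close> and the product only
  on draws at time \<open>n\<close>, so the two index sets are disjoint and the expectation factors.
  Several frogs are allowed at once because the extinction argument lets all active frogs die
  simultaneously.\<close>

lemma expectation_past_mult:
  fixes X :: "_ \<Rightarrow> real" and g :: "move \<Rightarrow> real"
  assumes X: "X \<in> borel_measurable (PiM (past n) (\<lambda>_. draw))"
      "\<And>\<omega>. X (restrict \<omega> (past n)) = X \<omega>" "\<And>\<omega>. \<bar>X \<omega>\<bar> \<le> B"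
    and S: "finite S" "S \<subseteq> tree_vertices d" and g: "\<And>m. \<bar>g m\<bar> \<le> C"
  shows "expectation (\<lambda>\<omega>. X \<omega> * (\<Prod>v\<in>S. g (\<omega> (v, n)))) =
    expectation X * measure_pmf.expectation (move_pmf d q p) g ^ card S"
proof -
  define T where "T = S \<times> {n}"
  define Y where "Y \<omega> = (\<Prod>i\<in>T. g (\<omega> i))" for \<omega>
  have T: "finite T" "T \<subseteq> tree_vertices d \<times> UNIV" using S by (auto simp: T_def)
  have Y_eq: "(\<Prod>v\<in>S. g (\<omega> (v, n))) = Y \<omega>" for \<omega>
  proof -
    have "T = (\<lambda>v. (v, n)) ` S" by (auto simp: T_def)
    then show ?thesis by (simp add: Y_def prod.reindex inj_on_def)
  qed
  have Y: "Y \<in> borel_measurable (PiM T (\<lambda>_. draw))"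
    unfolding Y_def
    by (intro borel_measurable_prod measurable_compose[OF measurable_component_singleton]) auto
  have "indep_var borel (X \<circ> (\<lambda>\<omega>. restrict (\<lambda>i. \<omega> i) (past n))) borel (Y \<circ> (\<lambda>\<omega>. restrict (\<lambda>i. \<omega> i) T))"
    by (rule indep_var_compose[OF indep_var_restrict[OF indep_draws] X(1) Y])
       (use S in \<open>auto simp: T_def\<close>)
  moreover have "X \<circ> (\<lambda>\<omega>. restrict (\<lambda>i. \<omega> i) (past n)) = X"
    using X(2) by auto
  moreover have "Y \<circ> (\<lambda>\<omega>. restrict (\<lambda>i. \<omega> i) T) = Y"
    by (auto simp: Y_def fun_eq_iff intro!: prod.cong)
  ultimately have ind: "indep_var borel X borel Y" by simp
  have int_X: "integrable M X"
    using indep_var_rv1[OF ind] X(3) by (rule integrable_bounded)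
  have "\<bar>Y \<omega>\<bar> \<le> C ^ card T" for \<omega>
    unfolding Y_def abs_prod using prod_mono[of T "\<lambda>i. \<bar>g (\<omega> i)\<bar>" "\<lambda>_. C"] g by simp
  with indep_var_rv2[OF ind] have int_Y: "integrable M Y"
    by (rule integrable_bounded)
  have "indep_vars (\<lambda>_. borel) (\<lambda>i \<omega>. g (\<omega> i)) T"
    by (rule indep_vars_compose2[OF indep_vars_subset[OF indep_draws T(2)]]) auto
  moreover have "integrable M (\<lambda>\<omega>. g (\<omega> i))" if "i \<in> T" for i
  proof (rule integrable_bounded[OF _ g])
    show "(\<lambda>\<omega>. g (\<omega> i)) \<in> borel_measurable M"
      using measurable_compose[OF draw_measurable[of "fst i" "snd i"], of g borel] that T by auto
  qed
  ultimately have "expectation Y = (\<Prod>i\<in>T. expectation (\<lambda>\<omega>. g (\<omega> i)))"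
    unfolding Y_def using T(1) by (intro indep_vars_lebesgue_integral) auto
  also have "\<dots> = (\<Prod>i\<in>T. measure_pmf.expectation (move_pmf d q p) g)"
    by (rule prod.cong) (use S in \<open>auto simp: T_def expectation_draw\<close>)
  also have "\<dots> = measure_pmf.expectation (move_pmf d q p) g ^ card S"
    by (simp add: T_def card_cartesian_product)
  finally show ?thesis
    unfolding Y_eq using indep_var_lebesgue_integral[OF ind int_X int_Y] by simp
qed

lemma expectation_config_mult:
  fixes f :: "frog_state \<Rightarrow> real" and g :: "move \<Rightarrow> real"
  assumes "v \<in> tree_vertices d" "\<And>s. \<bar>f s\<bar> \<le> B" "\<And>m. \<bar>g m\<bar> \<le> C"
  shows "expectation (\<lambda>\<omega>. f (frog_config d \<omega> n v) * g (\<omega> (v, n))) =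
    expectation (\<lambda>\<omega>. f (frog_config d \<omega> n v)) * measure_pmf.expectation (move_pmf d q p) g"
proof -
  have "(\<lambda>\<omega>. f (frog_config d \<omega> n v)) \<in> borel_measurable (PiM (past n) (\<lambda>_. draw))"
    by (rule measurable_compose[OF measurable_frog_config]) (use assms in auto)
  from expectation_past_mult[OF this _ assms(2), of "{v}" g C] assms show ?thesis
    by (simp add: frog_config_restrict)
qed

lemma integrable_config_mult:
  fixes f :: "frog_state \<Rightarrow> real" and g :: "move \<Rightarrow> real"
  assumes "v \<in> tree_vertices d" "\<And>s. \<bar>f s\<bar> \<le> B" "\<And>m. \<bar>g m\<bar> \<le> C"
  shows "integrable M (\<lambda>\<omega>. f (frog_config d \<omega> n v) * g (\<omega> (v, n)))"
proof (rule integrable_bounded[of _ "B * C"])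
  have "(\<lambda>\<omega>. f (frog_config d \<omega> n v)) \<in> borel_measurable M"
    by (rule measurable_compose[OF config_measurable[OF assms(1)]]) auto
  moreover have "(\<lambda>\<omega>. g (\<omega> (v, n))) \<in> borel_measurable M"
    by (rule measurable_compose[OF draw_measurable[OF assms(1)]]) auto
  ultimately show "(\<lambda>\<omega>. f (frog_config d \<omega> n v) * g (\<omega> (v, n))) \<in> borel_measurable M"
    by (rule borel_measurable_times)
  have "0 \<le> B" using assms(2)[of Dead] by linarith
  then show "\<bar>f (frog_config d \<omega> n v) * g (\<omega> (v, n))\<bar> \<le> B * C" for \<omega>
    unfolding abs_mult using assms by (intro mult_mono) auto
qed

lemma integrable_config:
  fixes f :: "frog_state \<Rightarrow> real"
  assumes "v \<in> tree_vertices d" "\<And>s. \<bar>f s\<bar> \<le> B"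
  shows "integrable M (\<lambda>\<omega>. f (frog_config d \<omega> n v))"
  using integrable_config_mult[OF assms, of "\<lambda>_. 1" 1] by simp

section \<open>Condition (a): expected number of active frogs and extinction\<close>

lemma active_frogs_measurable:
  fixes F :: "nat list set \<Rightarrow> real"
  shows "(\<lambda>\<omega>. F (active_frogs d \<omega> n)) \<in> borel_measurable M"
proof -
  let ?V = "Pow {v \<in> tree_vertices d. length v \<le> n}"
  \<comment> \<open>Only finitely many active sets are possible at time \<open>n\<close>, so every
    functional \<open>F\<close> is a finite combination of indicators.\<close>
  have "F (active_frogs d \<omega> n) = (\<Sum>S\<in>?V. of_bool (active_frogs d \<omega> n = S) * F S)" for \<omega>
    using active_frogs_subset[of d \<omega> n] finite_tree_vertices_length_le[of d n]
    by (simp add: of_bool_def if_distrib[of "\<lambda>x. x * _"] sum.delta' cong: if_cong)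
  moreover have "(\<lambda>\<omega>. \<Sum>S\<in>?V. of_bool (active_frogs d \<omega> n = S) * F S) \<in> borel_measurable M"
    using active_frogs_eq_measurable unfolding of_bool_def by measurable
  ultimately show ?thesis by simp
qed

lemma integrable_active_frogs:
  fixes F :: "nat list set \<Rightarrow> real"
  shows "integrable M (\<lambda>\<omega>. F (active_frogs d \<omega> n))"
proof (rule integrable_bounded[OF active_frogs_measurable])
  let ?V = "Pow {v \<in> tree_vertices d. length v \<le> n}"
  show "\<bar>F (active_frogs d \<omega> n)\<bar> \<le> (\<Sum>S\<in>?V. \<bar>F S\<bar>)" for \<omega>
    using active_frogs_subset[of d \<omega> n] finite_tree_vertices_length_le[of d n]
    by (intro member_le_sum) auto
qed

text \<open>Whether \<open>v\<close> is active at time \<open>n\<close> is independent of its next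
  draw, and \<open>q * (2 - p)\<close> is the mean of \<open>offspring\<close>. Dependence between
  different frogs does no harm, as only linearity of expectation is used across them.\<close>

lemma expectation_card_active_frogs_Suc_le:
  "expectation (\<lambda>\<omega>. real (card (active_frogs d \<omega> (Suc n)))) \<le>
    q * (2 - p) * expectation (\<lambda>\<omega>. real (card (active_frogs d \<omega> n)))"
proof -
  define V where "V = {v \<in> tree_vertices d. length v \<le> n}"
  define f :: "frog_state \<Rightarrow> real" where "f s = of_bool (\<exists>x. s = Active x)" for s
  have f: "\<bar>f s\<bar> \<le> 1" for s by (simp add: f_def)
  have g: "\<bar>offspring m\<bar> \<le> 2" for m by (cases m) auto
  have sum_f: "(\<Sum>v\<in>active_frogs d \<omega> n. h v) = (\<Sum>v\<in>V. f (frog_config d \<omega> n v) * h v)" for \<omega> h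
    by (simp add: sum_active_frogs V_def f_def)
  have V: "v \<in> tree_vertices d" if "v \<in> V" for v using that by (simp add: V_def)
  have mean: "measure_pmf.expectation (move_pmf d q p) offspring = q * (2 - p)"
    by (subst expectation_move_pmf[OF d_pos q p, where b = 2]) (auto simp: algebra_simps)
  have "expectation (\<lambda>\<omega>. real (card (active_frogs d \<omega> (Suc n)))) \<le>
      expectation (\<lambda>\<omega>. \<Sum>v\<in>V. f (frog_config d \<omega> n v) * offspring (\<omega> (v, n)))"
    using card_active_frogs_Suc_le[of d _ n] unfolding sum_f
    by (intro integral_mono integrable_active_frogs[of "\<lambda>S. real (card S)"] Bochner_Integration.integrable_sum
        integrable_config_mult[OF V f g])
  also have "\<dots> = (\<Sum>v\<in>V. expectation (\<lambda>\<omega>. f (frog_config d \<omega> n v)) * (q * (2 - p)))"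
    using integrable_config_mult[where f = f and g = offspring, OF V f g]
      expectation_config_mult[where f = f and g = offspring, OF V f g]
    by (simp add: Bochner_Integration.integral_sum mean)
  also have "\<dots> = q * (2 - p) * expectation (\<lambda>\<omega>. \<Sum>v\<in>V. f (frog_config d \<omega> n v))"
    using integrable_config[where f = f, OF V f]
    by (simp add: Bochner_Integration.integral_sum sum_distrib_left mult.commute)
  also have "(\<lambda>\<omega>. \<Sum>v\<in>V. f (frog_config d \<omega> n v)) = (\<lambda>\<omega>. real (card (active_frogs d \<omega> n)))"
    by (simp add: sum_active_frogs[of "\<lambda>_. 1", simplified] V_def f_def)
  finally show ?thesis .
qed

lemma expectation_card_active_frogs_le_1:
  assumes "q * (2 - p) \<le> 1"
  shows "expectation (\<lambda>\<omega>. real (card (active_frogs d \<omega> n))) \<le> 1"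
proof (induction n)
  case 0
  have "active_frogs d \<omega> 0 = {[]}" for \<omega>
    by (auto simp: active_frogs_def tree_vertices_def)
  then show ?case by (simp add: prob_space)
next
  case (Suc n)
  have "q * (2 - p) * expectation (\<lambda>\<omega>. real (card (active_frogs d \<omega> n)))
      \<le> 1 * expectation (\<lambda>\<omega>. real (card (active_frogs d \<omega> n)))"
    using assms by (intro mult_right_mono) auto
  then show ?case
    using expectation_card_active_frogs_Suc_le[of n] Suc by simp
qed

text \<open>Fixing the exact active set \<open>S\<close> gives an event of the past, while the frogs
  in \<open>S\<close> die in the next step independently, each with probability
  \<open>1 - q\<close>.\<close>

lemma expectation_dying_frogs:
  assumes "finite S" "S \<subseteq> tree_vertices d"
  shows "expectation (\<lambda>\<omega>. of_bool (active_frogs d \<omega> n = S) * (\<Prod>v\<in>S. of_bool (\<omega> (v, n) = Die))) =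
    expectation (\<lambda>\<omega>. of_bool (active_frogs d \<omega> n = S)) * (1 - q) ^ card S"
proof -
  have "(\<lambda>\<omega>. of_bool (active_frogs d \<omega> n = S) :: real) \<in> borel_measurable (PiM (past n) (\<lambda>_. draw))"
    using measurable_active_frogs_eq[OF subset_refl, where n = n and S = S] unfolding of_bool_def by measurable
  moreover have "active_frogs d (restrict \<omega> (past n)) n = active_frogs d \<omega> n" for \<omega>
    by (auto simp: active_frogs_def frog_config_restrict)
  moreover have "measure_pmf.expectation (move_pmf d q p) (\<lambda>m. of_bool (m = Die)) = 1 - q"
    by (subst expectation_move_pmf[OF d_pos q p, where b = 0]) auto
  ultimately show ?thesis
    using expectation_past_mult[of "\<lambda>\<omega>. of_bool (active_frogs d \<omega> n = S)" n 1 S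
        "\<lambda>m. of_bool (m = Die)" 1] assms by simp
qed

text \<open>By Markov's inequality the number of active frogs lies between \<open>1\<close> and
  \<open>K\<close> with probability at least \<open>e n - 1 / real K\<close>. From there all of them
  die at once with probability at least \<open>(1 - q) ^ K\<close>, and this mass is lost between
  \<open>e n\<close> and \<open>e (Suc n)\<close>.\<close>

lemma survival_decrease:
  assumes "q * (2 - p) \<le> 1" "K > 0"
  defines "e \<equiv> \<lambda>n. prob {\<omega> \<in> space M. active_frogs d \<omega> n \<noteq> {}}"
  shows "(1 - q) ^ K * (e n - 1 / real K) \<le> e n - e (Suc n)"
proof -
  define W where "W = {S \<in> Pow {v \<in> tree_vertices d. length v \<le> n}. S \<noteq> {} \<and> card S \<le> K}"
  have W: "finite W" "\<And>S. S \<in> W \<Longrightarrow> finite S \<and> S \<subseteq> tree_vertices d"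
    using finite_tree_vertices_length_le[of d n] by (auto simp: W_def intro: finite_subset)
  have e: "e n = expectation (\<lambda>\<omega>. of_bool (active_frogs d \<omega> n \<noteq> {}))" for n
    unfolding e_def using active_frogs_eq_measurable[of n "{}"]
    by (subst expectation_of_bool) auto
  \<comment> \<open>The events behind \<open>D S\<close> are disjoint for different
    \<open>S\<close>, and each of them forces extinction at time \<open>Suc n\<close>.\<close>
  define D where "D S \<omega> = of_bool (active_frogs d \<omega> n = S) * (\<Prod>v\<in>S. of_bool (\<omega> (v, n) = Die) :: real)"
    for S \<omega>
  have D: "integrable M (D S)" if "S \<in> W" for S
  proof (rule integrable_bounded)
    have "(\<lambda>\<omega>. of_bool (\<omega> (v, n) = Die) :: real) \<in> borel_measurable M" if "v \<in> S" for v
      using measurable_compose[OF draw_measurable[of v n], of "\<lambda>m. of_bool (m = Die)" borel] that W(2)[OF \<open>S \<in> W\<close>]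
      by auto
    then show "D S \<in> borel_measurable M"
      unfolding D_def
      by (intro borel_measurable_times borel_measurable_prod active_frogs_measurable[of "\<lambda>A. of_bool (A = S)"])
    show "\<bar>D S \<omega>\<bar> \<le> 1" for \<omega>
      by (auto simp: D_def abs_mult abs_prod intro!: mult_le_one prod_le_1 prod_nonneg)
  qed
  have "e n - 1 / real K \<le> e n - expectation (\<lambda>\<omega>. real (card (active_frogs d \<omega> n))) / real K"
    using expectation_card_active_frogs_le_1[OF assms(1), of n] by (simp add: divide_right_mono)
  also have "\<dots> = expectation (\<lambda>\<omega>. of_bool (active_frogs d \<omega> n \<noteq> {}) - real (card (active_frogs d \<omega> n)) / real K)"
    unfolding e
    by (subst Bochner_Integration.integral_diff)
       (auto intro: integrable_active_frogs[of "\<lambda>S. of_bool (S \<noteq> {})"] integrable_active_frogs[of "\<lambda>S. real (card S)"])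
  \<comment> \<open>Markov's inequality in pointwise form: outside \<open>W\<close> either no frog
    or at least \<open>K\<close> frogs are active, so the difference is at most \<open>0\<close>; on
    \<open>W\<close> it is at most \<open>1\<close>.\<close>
  also have "\<dots> \<le> expectation (\<lambda>\<omega>. \<Sum>S\<in>W. of_bool (active_frogs d \<omega> n = S))"
  proof (rule integral_mono)
    show "of_bool (active_frogs d \<omega> n \<noteq> {}) - real (card (active_frogs d \<omega> n)) / real K
        \<le> (\<Sum>S\<in>W. of_bool (active_frogs d \<omega> n = S))" for \<omega>
    proof (cases "active_frogs d \<omega> n \<in> W")
      case True
      then have "(\<Sum>S\<in>W. of_bool (active_frogs d \<omega> n = S)) = (1 :: real)"
        using W(1) by (simp add: of_bool_def sum.delta')
      then show ?thesis by simp
    next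
      case False
      then have "active_frogs d \<omega> n = {} \<or> K \<le> card (active_frogs d \<omega> n)"
        using active_frogs_subset[of d \<omega> n] by (auto simp: W_def)
      then have "of_bool (active_frogs d \<omega> n \<noteq> {}) - real (card (active_frogs d \<omega> n)) / real K \<le> 0"
        using \<open>K > 0\<close> by (auto simp: field_simps)
      also have "0 \<le> (\<Sum>S\<in>W. of_bool (active_frogs d \<omega> n = S) :: real)"
        by (intro sum_nonneg) auto
      finally show ?thesis .
    qed
  qed (use integrable_active_frogs[of "\<lambda>A. of_bool (A \<noteq> {}) - real (card A) / real K"]
        integrable_active_frogs[of "\<lambda>A. \<Sum>S\<in>W. of_bool (A = S)"] in auto)
  also have "\<dots> = (\<Sum>S\<in>W. expectation (\<lambda>\<omega>. of_bool (active_frogs d \<omega> n = S)))"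
    by (rule Bochner_Integration.integral_sum) (rule integrable_active_frogs)
  finally have "(1 - q) ^ K * (e n - 1 / real K) \<le>
      (\<Sum>S\<in>W. (1 - q) ^ K * expectation (\<lambda>\<omega>. of_bool (active_frogs d \<omega> n = S)))"
    using q by (simp add: mult_left_mono sum_distrib_left[symmetric])
  also have "\<dots> \<le> (\<Sum>S\<in>W. expectation (D S))"
  proof (rule sum_mono)
    fix S assume "S \<in> W"
    then have "(1 - q) ^ K \<le> (1 - q) ^ card S"
      using q by (intro power_decreasing) (auto simp: W_def)
    then have "(1 - q) ^ K * expectation (\<lambda>\<omega>. of_bool (active_frogs d \<omega> n = S))
        \<le> (1 - q) ^ card S * expectation (\<lambda>\<omega>. of_bool (active_frogs d \<omega> n = S))"
      by (intro mult_right_mono) auto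
    then show "(1 - q) ^ K * expectation (\<lambda>\<omega>. of_bool (active_frogs d \<omega> n = S)) \<le> expectation (D S)"
      unfolding D_def using W(2)[OF \<open>S \<in> W\<close>] by (simp add: expectation_dying_frogs mult.commute)
  qed
  also have "\<dots> = expectation (\<lambda>\<omega>. \<Sum>S\<in>W. D S \<omega>)"
    by (rule Bochner_Integration.integral_sum[symmetric]) (rule D)
  also have "\<dots> \<le> expectation (\<lambda>\<omega>. of_bool (active_frogs d \<omega> n \<noteq> {}) - of_bool (active_frogs d \<omega> (Suc n) \<noteq> {}))"
  proof (rule integral_mono)
    show "(\<Sum>S\<in>W. D S \<omega>) \<le> of_bool (active_frogs d \<omega> n \<noteq> {}) - of_bool (active_frogs d \<omega> (Suc n) \<noteq> {})"
      (is "_ \<le> ?R") for \<omega>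
    proof -
      define A where "A = active_frogs d \<omega> n"
      \<comment> \<open>Only the summand of the actual active set \<open>A\<close> can be nonzero.
        If all of \<open>A\<close> dies, nothing is subtracted on the right; otherwise the product
        is \<open>0\<close> and \<open>A\<close> is nonempty, so the right side is
        nonnegative.\<close>
      have "(\<Sum>S\<in>W. D S \<omega>) = (if A \<in> W then \<Prod>v\<in>A. of_bool (\<omega> (v, n) = Die) else 0)"
        unfolding D_def A_def[symmetric] using W(1)
        by (simp add: of_bool_def if_distrib[of "\<lambda>x. x * _"] sum.delta' cong: if_cong)
      also have "\<dots> \<le> of_bool (A \<noteq> {}) - of_bool (active_frogs d \<omega> (Suc n) \<noteq> {})"
      proof (cases "\<forall>v\<in>A. \<omega> (v, n) = Die")
        case True
        then have "active_frogs d \<omega> (Suc n) = {}"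
          by (intro active_frogs_Suc_empty) (simp add: A_def)
        with True show ?thesis by (auto simp: W_def)
      next
        case False
        then have "(\<Prod>v\<in>A. of_bool (\<omega> (v, n) = Die) :: real) = 0"
          by (intro prod_zero) (auto simp: A_def finite_active_frogs)
        with False show ?thesis by auto
      qed
      finally show ?thesis by (simp add: A_def)
    qed
  qed (use integrable_active_frogs[of "\<lambda>A. of_bool (A \<noteq> {})"] D in \<open>auto intro!: Bochner_Integration.integrable_diff\<close>)
  also have "\<dots> = e n - e (Suc n)"
    unfolding e by (rule Bochner_Integration.integral_diff) (rule integrable_active_frogs)+
  finally show ?thesis .
qed

text \<open>The survival probabilities decrease to some \<open>l\<close>. Letting \<open>n\<close>
  tend to infinity in \<open>survival_decrease\<close> for fixed \<open>K\<close> makes its right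
  side \<open>0\<close>, and as \<open>(1 - q) ^ K\<close> is positive, \<open>l\<close> is at most
  \<open>1 / real K\<close> for every \<open>K > 0\<close>.\<close>

lemma AE_transient_if_critical:
  assumes "q * (2 - p) \<le> 1" "q < 1"
  shows "AE \<omega> in M. transient d \<omega>"
proof -
  define E where "E n = {\<omega> \<in> space M. active_frogs d \<omega> n \<noteq> {}}" for n
  have E: "E n \<in> sets M" for n
    unfolding E_def using active_frogs_eq_measurable[of n "{}"] by measurable
  have dec: "decseq (\<lambda>n. prob (E n))"
  proof (rule decseq_SucI, rule finite_measure_mono[OF _ E])
    show "E (Suc n) \<subseteq> E n" for n
      using active_frogs_Suc_empty[of d _ n] by (auto simp: E_def)
  qed
  then obtain l where l: "(\<lambda>n. prob (E n)) \<longlonglongrightarrow> l" "\<And>n. l \<le> prob (E n)"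
    using decseq_convergent[of "\<lambda>n. prob (E n)" 0] by auto
  have "l \<le> 1 / real (Suc k)" for k
  proof -
    have "(1 - q) ^ Suc k * (l - 1 / real (Suc k)) \<le> l - l"
      by (rule LIMSEQ_le[OF tendsto_mult_left[OF tendsto_diff[OF l(1) tendsto_const]]
            tendsto_diff[OF l(1) LIMSEQ_Suc[OF l(1)]]])
         (use survival_decrease[OF assms(1), of "Suc k"] in \<open>auto simp: E_def\<close>)
    moreover have "0 < (1 - q) ^ Suc k"
      using \<open>q < 1\<close> by (intro zero_less_power) simp
    ultimately show ?thesis
      using mult_le_cancel_left_pos[of "(1 - q) ^ Suc k" "l - 1 / real (Suc k)" 0]
      by (simp del: power_Suc)
  qed
  then have "l \<le> 0"
    by (intro LIMSEQ_le_const[OF LIMSEQ_inverse_real_of_nat]) (auto simp: inverse_eq_divide)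
  have "prob (\<Inter>n. E n) \<le> prob (E n)" for n
    by (rule finite_measure_mono) (use E in auto)
  then have "prob (\<Inter>n. E n) \<le> l"
    by (intro LIMSEQ_le_const[OF l(1)]) auto
  with \<open>l \<le> 0\<close> have "prob (\<Inter>n. E n) = 0"
    using measure_nonneg[of M "\<Inter>n. E n"] by linarith
  moreover have "(\<Inter>n. E n) \<in> sets M" using E by auto
  ultimately have "AE \<omega> in M. \<omega> \<notin> (\<Inter>n. E n)"
    by (simp add: prob_eq_0)
  then show ?thesis
    using AE_space by eventually_elim (auto simp: E_def intro: transient_if_extinct)
qed

section \<open>Condition (b): visits to the root by single frogs\<close>

lemma expectation_potential_decrease:
  assumes v: "v \<in> tree_vertices d" and a: "0 < a" "a \<le> 1" "q * (p + (1 - p) * a\<^sup>2) \<le> a"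
  defines "\<phi> \<equiv> \<lambda>s. case s of Sleeping \<Rightarrow> a ^ length v | Active x \<Rightarrow> a ^ length x | Dead \<Rightarrow> 0"
  shows "expectation (\<lambda>\<omega>. \<phi> (frog_config d \<omega> (Suc n) v)) +
      (1 - q) * prob {\<omega> \<in> space M. frog_config d \<omega> n v = Active []} \<le>
    expectation (\<lambda>\<omega>. \<phi> (frog_config d \<omega> n v))"
proof -
  \<comment> \<open>A sleeping frog already carries the potential of its starting vertex, so waking
    changes nothing and the random waking time is irrelevant. The root is treated apart because
    \<open>Up\<close> does not move a frog there. In \<open>f2\<close> the exponent is that of the
    parent, so \<open>Up\<close> contributes the factor \<open>1\<close> and \<open>Down\<close> the
    factor \<open>a\<^sup>2\<close>.\<close>
  define f0 where "f0 s = of_bool (s = Sleeping) * a ^ length v" for s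
  define f1 :: "frog_state \<Rightarrow> real" where "f1 s = of_bool (s = Active [])" for s
  define f2 where "f2 s = (case s of Active (i # x) \<Rightarrow> a ^ length x | _ \<Rightarrow> 0)" for s
  define g1 where "g1 m = (case m of Die \<Rightarrow> 0 | Up \<Rightarrow> 1 | Down i \<Rightarrow> a)" for m
  define g2 where "g2 m = (case m of Die \<Rightarrow> 0 | Up \<Rightarrow> 1 | Down i \<Rightarrow> a\<^sup>2)" for m
  have pow: "\<bar>a ^ k\<bar> \<le> 1" for k using a by (simp add: power_le_one)
  have bounds: "\<bar>f0 s\<bar> \<le> 1" "\<bar>f1 s\<bar> \<le> 1" "\<bar>f2 s\<bar> \<le> 1" "\<bar>g1 m\<bar> \<le> 1" "\<bar>g2 m\<bar> \<le> 1" for s m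
    using pow a by (auto simp: f0_def f1_def f2_def g1_def g2_def
        split: frog_state.split list.split move.split)
  let ?c = "\<lambda>\<omega>. frog_config d \<omega> n v"
  have step: "\<phi> (frog_config d \<omega> (Suc n) v) =
      f0 (?c \<omega>) + f1 (?c \<omega>) * g1 (\<omega> (v, n)) + f2 (?c \<omega>) * g2 (\<omega> (v, n))" for \<omega>
  proof (cases "?c \<omega>")
    case Sleeping
    then show ?thesis by (simp add: frog_step_def \<phi>_def f0_def f1_def f2_def)
  next
    case (Active x)
    then show ?thesis
      by (cases x; cases "\<omega> (v, n)")
         (simp_all add: frog_step_def \<phi>_def f0_def f1_def f2_def g1_def g2_def power2_eq_square)
  next
    case Dead
    then show ?thesis by (simp add: frog_step_def \<phi>_def f0_def f1_def f2_def)
  qed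
  have \<phi>_eq: "\<phi> s = f0 s + f1 s + a * f2 s" for s
    by (auto simp: \<phi>_def f0_def f1_def f2_def split: frog_state.split list.split)
  note int = integrable_config[where f = f0, OF v bounds(1)]
    integrable_config[where f = f1, OF v bounds(2)]
    integrable_config[where f = f2, OF v bounds(3)]
    integrable_config_mult[where f = f1 and g = g1, OF v bounds(2,4)]
    integrable_config_mult[where f = f2 and g = g2, OF v bounds(3,5)]
  have g1: "measure_pmf.expectation (move_pmf d q p) g1 = q * (p + (1 - p) * a)"
    by (subst expectation_move_pmf[OF d_pos q p, where b = a]) (auto simp: g1_def)
  have g2: "measure_pmf.expectation (move_pmf d q p) g2 = q * (p + (1 - p) * a\<^sup>2)"
    by (subst expectation_move_pmf[OF d_pos q p, where b = "a\<^sup>2"]) (auto simp: g2_def)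
  have "p + (1 - p) * a \<le> 1"
    using p a mult_left_le[of a "1 - p"] by linarith
  then have le1: "q * (p + (1 - p) * a) \<le> q"
    using q mult_left_le[of "p + (1 - p) * a" q] by simp
  have "Measurable.pred M (\<lambda>\<omega>. ?c \<omega> = Active [])"
    by (rule measurable_compose[OF config_measurable[OF v]]) simp
  then have f1: "expectation (\<lambda>\<omega>. f1 (?c \<omega>)) = prob {\<omega> \<in> space M. ?c \<omega> = Active []}"
    unfolding f1_def by (rule expectation_of_bool)
  have nonneg: "0 \<le> expectation (\<lambda>\<omega>. f1 (?c \<omega>))" "0 \<le> expectation (\<lambda>\<omega>. f2 (?c \<omega>))"
    using a by (auto simp: f1_def f2_def intro!: Bochner_Integration.integral_nonneg split: frog_state.split list.split)
  have "expectation (\<lambda>\<omega>. \<phi> (frog_config d \<omega> (Suc n) v)) =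
      expectation (\<lambda>\<omega>. f0 (?c \<omega>)) + expectation (\<lambda>\<omega>. f1 (?c \<omega>)) * (q * (p + (1 - p) * a))
        + expectation (\<lambda>\<omega>. f2 (?c \<omega>)) * (q * (p + (1 - p) * a\<^sup>2))"
    unfolding step using int
    by (simp add: g1 g2
        expectation_config_mult[where f = f1 and g = g1, OF v bounds(2,4)]
        expectation_config_mult[where f = f2 and g = g2, OF v bounds(3,5)])
  \<comment> \<open>Below the root the inequality assumed for \<open>a\<close> prevents an increase;
    at the root the potential falls from \<open>1\<close> to at most \<open>q\<close> on average,
    which is the source of the term with \<open>1 - q\<close>.\<close>
  also have "\<dots> \<le> expectation (\<lambda>\<omega>. f0 (?c \<omega>)) + expectation (\<lambda>\<omega>. f1 (?c \<omega>)) * q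
      + expectation (\<lambda>\<omega>. f2 (?c \<omega>)) * a"
    using nonneg le1 a(3) by (intro add_mono mult_left_mono order_refl)
  also have "\<dots> = expectation (\<lambda>\<omega>. \<phi> (?c \<omega>)) - (1 - q) * expectation (\<lambda>\<omega>. f1 (?c \<omega>))"
    unfolding \<phi>_eq using int by (simp add: algebra_simps)
  finally show ?thesis unfolding f1 by simp
qed

text \<open>Summing the decrease over time bounds the expected number of time steps that frog
  \<open>v\<close> spends at the root, and a union bound over times turns this into a
  probability.\<close>

lemma prob_visits_root_le:
  assumes v: "v \<in> tree_vertices d" and a: "0 < a" "a \<le> 1" "q * (p + (1 - p) * a\<^sup>2) \<le> a" and "q < 1"
  shows "prob {\<omega> \<in> space M. \<exists>n. frog_config d \<omega> n v = Active []} \<le> a ^ length v / (1 - q)"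
proof -
  define \<phi> where "\<phi> s = (case s of Sleeping \<Rightarrow> a ^ length v | Active x \<Rightarrow> a ^ length x | Dead \<Rightarrow> 0)" for s
  define R where "R n = {\<omega> \<in> space M. frog_config d \<omega> n v = Active []}" for n
  have R: "R n \<in> sets M" for n
    unfolding R_def using measurable_compose[OF config_measurable[OF v], of "\<lambda>s. s = Active []" "count_space UNIV" n]
    by (simp add: pred_def)
  have "(1 - q) * (\<Sum>k<n. prob (R k)) + expectation (\<lambda>\<omega>. \<phi> (frog_config d \<omega> n v)) \<le> a ^ length v" for n
  proof (induction n)
    case 0
    \<comment> \<open>The root frog starts active with potential \<open>1 = a ^ 0\<close>, every
      other frog asleep with \<open>a ^ length v\<close>, so one formula covers both.\<close>
    show ?case by (cases "v = []") (simp_all add: \<phi>_def prob_space)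
  next
    case (Suc n)
    then show ?case
      using expectation_potential_decrease[OF v a, of n]
      by (simp add: \<phi>_def R_def algebra_simps)
  qed
  moreover have "0 \<le> expectation (\<lambda>\<omega>. \<phi> (frog_config d \<omega> n v))" for n
    using a by (auto simp: \<phi>_def intro!: Bochner_Integration.integral_nonneg split: frog_state.split)
  ultimately have "(1 - q) * (\<Sum>k<n. prob (R k)) \<le> a ^ length v" for n
    by (smt (verit))
  then have le: "(\<Sum>k<n. prob (R k)) \<le> a ^ length v / (1 - q)" for n
    using \<open>q < 1\<close> by (simp add: pos_le_divide_eq mult.commute)
  then have summable: "summable (\<lambda>k. prob (R k))"
    by (intro summableI_nonneg_bounded) auto
  have "{\<omega> \<in> space M. \<exists>n. frog_config d \<omega> n v = Active []} = (\<Union>n. R n)"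
    by (auto simp: R_def)
  also have "prob \<dots> \<le> (\<Sum>n. prob (R n))"
    using R summable by (intro finite_measure_subadditive_countably) auto
  also have "\<dots> \<le> a ^ length v / (1 - q)"
    by (rule suminf_le_const[OF summable le])
  finally show ?thesis .
qed

text \<open>The events are grouped by level: some frog started at level \<open>k\<close> reaches the
  root. Their probabilities are dominated by a geometric series of ratio \<open>a * real d\<close>,
  so almost surely visitors come from finitely many levels, each of which is finite.\<close>

lemma AE_transient_if_supermartingale:
  assumes a: "0 < a" "a * real d < 1" "q * (p + (1 - p) * a\<^sup>2) \<le> a" and "q < 1"
  shows "AE \<omega> in M. transient d \<omega>"
proof -
  define L where "L k = {v \<in> tree_vertices d. length v = k}" for k
  define R where "R v = {\<omega> \<in> space M. \<exists>n. frog_config d \<omega> n v = Active []}" for v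
  have L: "finite (L k)" "card (L k) = d ^ k" for k
    using finite_lists_length_eq[of "{..<d}" k] card_lists_length_eq[of "{..<d}" k]
    by (simp_all add: L_def tree_vertices_def lists_eq_set)
  have R: "R v \<in> sets M" if "v \<in> tree_vertices d" for v
  proof -
    have "Measurable.pred M (\<lambda>\<omega>. \<exists>n. frog_config d \<omega> n v = Active [])"
      by (intro pred_intros_countable measurable_compose[OF config_measurable[OF that]]) simp
    then show ?thesis by (simp add: R_def pred_def)
  qed
  have UR: "(\<Union>v\<in>L k. R v) \<in> sets M" for k
    using L R by (intro sets.finite_UN) (auto simp: L_def)
  have "a \<le> a * real d" using a d_pos by simp
  then have "a \<le> 1" using a by linarith
  have bound: "prob (\<Union>v\<in>L k. R v) \<le> (a * real d) ^ k / (1 - q)" for k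
  proof -
    have "prob (\<Union>v\<in>L k. R v) \<le> (\<Sum>v\<in>L k. prob (R v))"
      using L R by (intro finite_measure_subadditive_finite) (auto simp: L_def)
    also have "\<dots> \<le> (\<Sum>v\<in>L k. a ^ k / (1 - q))"
      using prob_visits_root_le[OF _ a(1) \<open>a \<le> 1\<close> a(3) \<open>q < 1\<close>]
      by (intro sum_mono) (auto simp: L_def R_def)
    also have "\<dots> = (a * real d) ^ k / (1 - q)"
      by (simp add: L power_mult_distrib)
    finally show ?thesis .
  qed
  have "summable (\<lambda>k. (a * real d) ^ k / (1 - q))"
    using a by (intro summable_divide summable_geometric) (auto simp: abs_mult)
  then have "summable (\<lambda>k. prob (\<Union>v\<in>L k. R v))"
    by (rule summable_comparison_test'[where N = 0]) (use bound in auto)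
  then have "AE \<omega> in M. eventually (\<lambda>k. \<omega> \<in> space M - (\<Union>v\<in>L k. R v)) sequentially"
    using UR by (intro borel_cantelli_AE1) (auto simp: emeasure_eq_measure)
  then show ?thesis
  proof eventually_elim
    case (elim \<omega>)
    then obtain N where N: "\<And>k. k \<ge> N \<Longrightarrow> \<omega> \<in> space M - (\<Union>v\<in>L k. R v)"
      by (auto simp: eventually_sequentially)
    have "{v \<in> tree_vertices d. \<exists>n. frog_config d \<omega> n v = Active []}
        \<subseteq> {v \<in> tree_vertices d. length v \<le> N}"
    proof safe
      fix v n assume "v \<in> tree_vertices d" "frog_config d \<omega> n v = Active []"
      then have "\<not> N \<le> length v"
        using N[of "length v"] by (auto simp: L_def R_def)
      then show "length v \<le> N" by simp
    qed
    then show ?case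
      unfolding transient_def recurrent_def
      using finite_tree_vertices_length_le finite_subset by blast
  qed
qed

end

section \<open>From the parameter conditions to the two criteria\<close>

theorem proposition2:
  fixes d :: nat and q p :: real
  assumes "d \<ge> 2"
    and "0 \<le> q" and "q < 1"
    and "0 \<le> p" and "p \<le> 1"
    and "(q \<le> 1 / 2 \<or> (q > 0 \<and> p \<ge> 2 - inverse q)) \<or> p < 1 / (1 + q * real d)"
  shows "AE \<omega> in frog_space d q p. transient d \<omega>"
proof -
  interpret frog_model d q p
    using assms by unfold_locales auto
  show ?thesis
  proof (cases "q * (2 - p) \<le> 1")
    case True
    then show ?thesis using \<open>q < 1\<close> by (rule AE_transient_if_critical)
  next
    case False
    \<comment> \<open>Both alternatives of (a) give \<open>q * (2 - p) \<le> 1\<close>: the first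
      because \<open>2 - p \<le> 2\<close>, the second after multiplying by \<open>q\<close>. So
      only (b) remains here.\<close>
    have "\<not> q \<le> 1 / 2"
      using False mult_mono[of q "1 / 2" "2 - p" 2] assms by auto
    moreover have "\<not> (q > 0 \<and> p \<ge> 2 - inverse q)"
      using False by (auto simp: field_simps)
    ultimately have "q > 0" and b: "p < 1 / (1 + q * real d)"
      using assms by auto
    \<comment> \<open>With \<open>h x = q * (p + (1 - p) * x\<^sup>2)\<close> the requirement is
      \<open>h a \<le> a\<close>. As \<open>h\<close> is monotone for nonnegative arguments, the
      choice \<open>a = h (1 / real d)\<close> reduces it to \<open>a \<le> 1 / real d\<close>, and
      no quadratic equation has to be solved.\<close>
    define a where "a = q * (p + (1 - p) * (1 / real d)\<^sup>2)"
    have d: "0 < real d" using assms by simp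
    have "0 < p + (1 - p) * (1 / real d)\<^sup>2"
      using d \<open>0 \<le> p\<close> \<open>p \<le> 1\<close> by (cases "p = 0") (simp_all add: add_pos_nonneg)
    then have "0 < a"
      using \<open>q > 0\<close> by (simp add: a_def)
    moreover have ad: "a * real d < 1"
    proof -
      have p_less: "p * (1 + q * real d) < 1"
        using b \<open>q > 0\<close> d by (simp add: pos_less_divide_eq add_pos_pos)
      have "1 / real d \<le> 1" "1 \<le> real d"
        using \<open>d \<ge> 2\<close> by auto
      then have "0 \<le> real d - 1 / real d" by linarith
      then have diff: "0 \<le> q * (real d - 1 / real d)"
        using \<open>q > 0\<close> by simp
      \<comment> \<open>\<open>a * real d\<close> is affine in \<open>p\<close> with slope
        \<open>q * (real d - 1 / real d) \<ge> 0\<close>, so (b) allows \<open>p\<close> to be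
        replaced by its upper bound \<open>1 / (1 + q * real d)\<close>. After clearing the
        denominator, \<open>q * q < 1\<close> is left.\<close>
      have "(1 + q * real d) * (a * real d) =
          q / real d * (1 + q * real d) + q * (real d - 1 / real d) * (p * (1 + q * real d))"
        using d unfolding a_def by (simp add: field_simps power2_eq_square)
      also have "\<dots> \<le> q / real d * (1 + q * real d) + q * (real d - 1 / real d) * 1"
        using p_less diff by (intro add_left_mono mult_left_mono) auto
      also have "\<dots> = q * q + q * real d"
        using d by (simp add: field_simps)
      also have "\<dots> < 1 + q * real d"
        using \<open>q > 0\<close> \<open>q < 1\<close> mult_strict_mono[of q 1 q 1] by simp
      finally show ?thesis
        using \<open>q > 0\<close> d by (simp add: add_pos_pos)
    qed
    moreover have "q * (p + (1 - p) * a\<^sup>2) \<le> a"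
    proof -
      have "a \<le> 1 / real d" using ad d by (simp add: pos_le_divide_eq)
      then have "a\<^sup>2 \<le> (1 / real d)\<^sup>2"
        using \<open>0 < a\<close> by (intro power_mono) auto
      then have "q * (p + (1 - p) * a\<^sup>2) \<le> q * (p + (1 - p) * (1 / real d)\<^sup>2)"
        using \<open>q > 0\<close> \<open>p \<le> 1\<close> by (intro mult_left_mono add_left_mono) auto
      then show ?thesis by (simp only: a_def[symmetric])
    qed
    ultimately show ?thesis
      using \<open>q < 1\<close> by (rule AE_transient_if_supermartingale)
  qed
qed

end
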